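(* Assume that $g\ge 0$ is a continuously differentiable function on $[0,\infty)$ satisfying $$\dot g(t)\le -a(t)f(g(t))+b(t)\quad (t\ge 0),\qquad g(0)=g_0,$$ where $f$ is a nonnegative continuous function on $[0,\infty)$, $f(0)=0$, $f(t)>0$ for $t>0$, and $$m(\epsilon):=\inf_{x\ge\epsilon}f(x)>0,\qquad \forall \epsilon>0.$$ If $a(t)>0$ and $b(t)\ge 0$ are continuous functions on $[0,\infty)$, and $$\int_0^\infty a(s)\,ds=\infty,\qquad \lim_{t\to\infty}\frac{b(t)}{a(t)}=0,$$ then $$\lim_{t\to\infty}g(t)=0.$$ *)

theory Defs
  imports "HOL-Analysis.Analysis"
begin

end

theory Submission
  imports Defs
begin

text \<open>
  Fix a level \<open>\<epsilon> > 0\<close> and let \<open>m > 0\<close> be the infimum of \<open>f\<close> on \<open>[\<epsilon>, \<infinity>)\<close>. Since \<open>b / a\<close> tends to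
  \<open>0\<close>, eventually \<open>b \<le> (m / 2) a\<close>, and from then on \<open>g' \<le> - m a + (m / 2) a = - (m / 2) a\<close> at every
  time at which \<open>g \<ge> \<epsilon>\<close>. This one estimate is used twice.

  First, \<open>g\<close> must drop below \<open>\<epsilon>\<close> at some late time: otherwise \<open>g\<close> would decrease forever at rate at
  least \<open>(m / 2) a\<close>, whose integral diverges, so \<open>g\<close> would tend to \<open>-\<infinity>\<close>
  (\<open>decay_rate_diverges_imp_at_bot\<close>), which contradicts \<open>g \<ge> 0\<close>. Second, once below \<open>\<epsilon>\<close>,
  \<open>g\<close> can never reach \<open>\<epsilon>\<close> again, because its derivative there would be negative
  (\<open>stays_below_barrier\<close>).
\<close>

text \<open>
  At the first time of contact with the level \<open>c\<close> the negative derivative would force \<open>g > c\<close>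
  slightly earlier, hence an even earlier contact.
\<close>

lemma stays_below_barrier:
  fixes g g' :: "real \<Rightarrow> real"
  assumes deriv: "\<And>u. u \<ge> t\<^sub>1 \<Longrightarrow> (g has_real_derivative g' u) (at u)"
    and start: "g t\<^sub>1 < c"
    and barrier: "\<And>u. u \<ge> t\<^sub>1 \<Longrightarrow> g u = c \<Longrightarrow> g' u < 0"
    and t: "t \<ge> t\<^sub>1"
  shows "g t < c"
proof (rule ccontr)
  assume above: "\<not> g t < c"
  have cont: "continuous_on {t\<^sub>1..u} g" for u
    by (intro continuous_at_imp_continuous_on ballI DERIV_isCont[OF deriv]) simp
  have crossing: "\<exists>x\<ge>t\<^sub>1. x \<le> u \<and> g x = c" if "t\<^sub>1 \<le> u" "c \<le> g u" for u
    using IVT'[of g t\<^sub>1 c u] start that cont by auto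
  define C where "C = {u \<in> {t\<^sub>1..t}. g u = c}"
  have "C \<noteq> {}"
    using crossing[OF t] above by (auto simp: C_def)
  moreover have "compact C"
    unfolding compact_eq_bounded_closed
  proof
    show "bounded C"
      by (rule bounded_subset[OF bounded_closed_interval[of t\<^sub>1 t]]) (auto simp: C_def)
    show "closed C"
      unfolding C_def by (rule continuous_closed_preimage_constant[OF cont closed_atLeastAtMost])
  qed
  ultimately obtain s where s: "s \<in> C" and first: "\<And>u. u \<in> C \<Longrightarrow> s \<le> u"
    using compact_attains_inf[of C] by auto
  have s_props: "t\<^sub>1 < s" "s \<le> t" "g s = c"
    using s start by (auto simp: C_def less_le)
  have "g' s < 0"
    using barrier s_props by simp
  then obtain d where d: "d > 0" "\<And>h. 0 < h \<Longrightarrow> h < d \<Longrightarrow> g s < g (s - h)"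
    using DERIV_neg_dec_left[OF deriv[OF less_imp_le[OF s_props(1)]]] by blast
  define h where "h = min (d / 2) (s - t\<^sub>1)"
  have h: "0 < h" "h < d" "t\<^sub>1 \<le> s - h"
    using d(1) s_props by (auto simp: h_def)
  then have "c \<le> g (s - h)"
    using d(2)[of h] s_props(3) by simp
  then obtain x where x: "x \<ge> t\<^sub>1" "x \<le> s - h" "g x = c"
    using crossing[OF h(3)] by blast
  then have "x \<in> C"
    using h(1) s_props(2) by (simp add: C_def)
  with first[of x] x(2) h(1) show False
    by simp
qed

text \<open>
  The function \<open>g\<close> plus the primitive of \<open>h\<close> is nonincreasing, so \<open>g\<close> lies below a constant minus
  that primitive. The primitive starts at \<open>0\<close>, so \<open>T > 0\<close> makes it differentiable from both sides
  on all of \<open>[T, \<infinity>)\<close>.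
\<close>

lemma decay_rate_diverges_imp_at_bot:
  fixes g g' h :: "real \<Rightarrow> real"
  assumes "T > 0"
    and deriv: "\<And>t. t \<ge> T \<Longrightarrow> (g has_real_derivative g' t) (at t)"
    and decay: "\<And>t. t \<ge> T \<Longrightarrow> g' t \<le> - h t"
    and cont: "continuous_on {0..} h"
    and diverges: "filterlim (\<lambda>t. integral {0..t} h) at_top at_top"
  shows "filterlim g at_bot at_top"
proof -
  define H where "H = (\<lambda>t. integral {0..t} h)"
  have H_deriv: "(H has_real_derivative h t) (at t)" if "t > 0" for t
  proof -
    have "(H has_real_derivative h t) (at t within {0..t + 1})"
      unfolding H_def using that
      by (intro integral_has_real_derivative continuous_on_subset[OF cont]) auto
    moreover have "at t within {0..t + 1} = at t"
      using that by (intro at_within_interior) auto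
    ultimately show ?thesis by simp
  qed
  have bound: "g t \<le> (g T + H T) - H t" if "t \<ge> T" for t
  proof -
    have "g t + H t \<le> g T + H T"
    proof (rule DERIV_nonpos_imp_nonincreasing[OF that])
      fix x assume x: "T \<le> x" "x \<le> t"
      have "((\<lambda>u. g u + H u) has_real_derivative g' x + h x) (at x)"
        using x \<open>T > 0\<close> by (intro DERIV_add deriv H_deriv) auto
      with decay[OF x(1)] show "\<exists>y. ((\<lambda>u. g u + H u) has_real_derivative y) (at x) \<and> y \<le> 0"
        by (intro exI[of _ "g' x + h x"]) auto
    qed
    then show ?thesis by simp
  qed
  show ?thesis
    unfolding filterlim_at_bot
  proof
    fix Z
    have "eventually (\<lambda>t. g T + H T - Z \<le> H t) at_top"
      using diverges by (simp add: filterlim_at_top H_def)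
    with eventually_ge_at_top[of T] show "eventually (\<lambda>t. g t \<le> Z) at_top"
    proof eventually_elim
      case (elim t)
      with bound[of t] show ?case by simp
    qed
  qed
qed

theorem theorem2p11:
  fixes g g' f a b :: "real \<Rightarrow> real" and g\<^sub>0 :: real
  assumes g_nonneg: "\<And>t. t \<ge> 0 \<Longrightarrow> g t \<ge> 0"
    and g_deriv: "\<And>t. t \<ge> 0 \<Longrightarrow> (g has_real_derivative g' t) (at t within {0..})"
    and g'_cont: "continuous_on {0..} g'"
    and g_ineq: "\<And>t. t \<ge> 0 \<Longrightarrow> g' t \<le> - a t * f (g t) + b t"
    and g_init: "g 0 = g\<^sub>0"
    and f_nonneg: "\<And>x. x \<ge> 0 \<Longrightarrow> f x \<ge> 0"
    and f_cont: "continuous_on {0..} f"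
    and f_zero: "f 0 = 0"
    and f_pos: "\<And>x. x > 0 \<Longrightarrow> f x > 0"
    and f_inf: "\<And>\<epsilon>. \<epsilon> > 0 \<Longrightarrow> (INF x\<in>{\<epsilon>..}. f x) > 0"
    and a_pos: "\<And>t. t \<ge> 0 \<Longrightarrow> a t > 0"
    and a_cont: "continuous_on {0..} a"
    and b_nonneg: "\<And>t. t \<ge> 0 \<Longrightarrow> b t \<ge> 0"
    and b_cont: "continuous_on {0..} b"
    and a_int: "filterlim (\<lambda>T. integral {0..T} a) at_top at_top"
    and b_over_a: "((\<lambda>t. b t / a t) \<longlongrightarrow> 0) at_top"
  shows "(g \<longlongrightarrow> 0) at_top"
proof -
  have deriv: "(g has_real_derivative g' t) (at t)" if "t > 0" for t
  proof -
    have "at t within {0..} = at t"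
      using that by (intro at_within_interior) auto
    with g_deriv[of t] that show ?thesis by simp
  qed
  have below: "eventually (\<lambda>t. g t < \<epsilon>) at_top" if "\<epsilon> > 0" for \<epsilon>
  proof -
    define m where "m = (INF x\<in>{\<epsilon>..}. f x)"
    have m_pos: "m > 0"
      using f_inf[OF that] by (simp add: m_def)
    have m_le: "m \<le> f x" if "x \<ge> \<epsilon>" for x
      unfolding m_def using that \<open>\<epsilon> > 0\<close> f_nonneg
      by (intro cINF_lower bdd_belowI2[where m = 0]) auto
    have "eventually (\<lambda>t. b t / a t < m / 2) at_top"
      using order_tendstoD(2)[OF b_over_a half_gt_zero[OF m_pos]] .
    then obtain N where N: "\<And>t. t \<ge> N \<Longrightarrow> b t / a t < m / 2"
      unfolding eventually_at_top_linorder by blast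
    define T where "T = max N 1"
    have T: "T > 0" "T \<ge> N"
      by (auto simp: T_def)
    have decay: "g' t \<le> - (m / 2 * a t)" if "t \<ge> T" "g t \<ge> \<epsilon>" for t
    proof -
      have "a t > 0"
        using a_pos that T by simp
      have "b t \<le> m / 2 * a t"
        using N[of t] that T \<open>a t > 0\<close> by (simp add: field_simps)
      moreover have "a t * m \<le> a t * f (g t)"
        using m_le[OF that(2)] \<open>a t > 0\<close> by simp
      moreover have "g' t \<le> - a t * f (g t) + b t"
        using g_ineq that T by simp
      ultimately show ?thesis
        by (simp add: algebra_simps)
    qed
    have "\<exists>t\<^sub>1\<ge>T. g t\<^sub>1 < \<epsilon>"
    proof (rule ccontr)
      assume "\<not> (\<exists>t\<^sub>1\<ge>T. g t\<^sub>1 < \<epsilon>)"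
      then have above: "g t \<ge> \<epsilon>" if "t \<ge> T" for t
        using that by force
      have "filterlim g at_bot at_top"
      proof (rule decay_rate_diverges_imp_at_bot[OF T(1)])
        show "(g has_real_derivative g' t) (at t)" if "t \<ge> T" for t
          using deriv that T by simp
        show "g' t \<le> - (m / 2 * a t)" if "t \<ge> T" for t
          using decay above that by blast
        show "continuous_on {0..} (\<lambda>t. m / 2 * a t)"
          by (intro continuous_intros a_cont)
        have "filterlim (\<lambda>t. m / 2 * integral {0..t} a) at_top at_top"
          using m_pos by (intro filterlim_tendsto_pos_mult_at_top[OF tendsto_const _ a_int]) simp
        then show "filterlim (\<lambda>t. integral {0..t} (\<lambda>s. m / 2 * a s)) at_top at_top"
          by (simp only: integral_mult_right)
      qed
      then have "eventually (\<lambda>t. g t \<le> - 1) at_top"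
        by (simp add: filterlim_at_bot)
      then obtain t where "t \<ge> 0" "g t \<le> - 1"
        unfolding eventually_at_top_linorder by (meson linorder_linear order_refl)
      with g_nonneg[of t] show False
        by simp
    qed
    then obtain t\<^sub>1 where t1: "t\<^sub>1 \<ge> T" "g t\<^sub>1 < \<epsilon>"
      by blast
    have "g t < \<epsilon>" if "t \<ge> t\<^sub>1" for t
    proof (rule stays_below_barrier[where g = g and g' = g', OF _ t1(2) _ that])
      show "(g has_real_derivative g' u) (at u)" if "u \<ge> t\<^sub>1" for u
        using deriv that t1 T by simp
      show "g' u < 0" if "u \<ge> t\<^sub>1" "g u = \<epsilon>" for u
      proof -
        have "0 < m / 2 * a u"
          using m_pos a_pos that t1 T by simp
        with decay[of u] that t1 show ?thesis by simp
      qed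
    qed
    then show ?thesis
      unfolding eventually_at_top_linorder by blast
  qed
  show ?thesis
  proof (rule order_tendstoI)
    show "eventually (\<lambda>t. y < g t) at_top" if "y < 0" for y
      using eventually_ge_at_top[of 0]
      by eventually_elim (rule less_le_trans[OF that g_nonneg])
  qed (rule below)
qed

end
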